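(* Let $\mathbf u$ and $\mathbf u'$ be Sturmian words over $\{0,1\}$ such that $\mathbf u$ starts with the letter $1$ and $\mathbf u=\varphi_a(\mathbf u')$, where $\varphi_a: 0\mapsto 0,\ 1\mapsto 10$. Then $\mathbf u'$ starts with $1$ and $\mathrm{Der}(\mathbf u)=\mathrm{Der}(\mathbf u')$. In particular, for any prefix $w$ of $\mathbf u$ there exists a prefix $w'$ of $\mathbf u'$ such that $|w'|\le|w|$ and $d_{\mathbf u}(w)=d_{\mathbf u'}(w')$ (up to a permutation of letters). Moreover, if $w$ is right special, then $w'$ is right special as well.
   Context: A Sturmian word is an infinite word with exactly $n+1$ factors of length $n$ for all $n$; such words are binary and uniformly recurrent. For a prefix $w$ of a uniformly recurrent word $\mathbf u=u_0u_1\cdots$, a return word to $w$ is $u_i\cdots u_{j-1}$ where $i<j$ are consecutive occurrences of $w$ in $\mathbf u$. Writing the return words as $r_0,\dots,r_{k-1}$, $\mathbf u$ factors uniquely as $r_{s_0}r_{s_1}\cdots$ and the derivated word is $d_{\mathbf u}(w)=s_0s_1s_2\cdots$; derivated words differing by a renaming of letters are identified, and $\mathrm{Der}(\mathbf u)=\{d_{\mathbf u}(w): w\text{ a prefix of }\mathbf u\}$. A factor $v$ is right special if $vx$ and $vy$ are factors for two distinct letters $x,y$.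
   Formalization: Prefixes w, w' are taken nonempty, also in Der: for the empty prefix w the claim would force w' empty and u = u' up to renaming, hence u = 1000…, which is not Sturmian. *)

theory Defs
  imports "HOL-Library.Stream"
begin

definition occurs_at :: "'a list \<Rightarrow> 'a stream \<Rightarrow> nat \<Rightarrow> bool" where
  "occurs_at w u i \<longleftrightarrow> stake (length w) (sdrop i u) = w"

definition is_factor :: "'a list \<Rightarrow> 'a stream \<Rightarrow> bool" where
  "is_factor w u \<longleftrightarrow> (\<exists>i. occurs_at w u i)"

definition is_prefix :: "'a list \<Rightarrow> 'a stream \<Rightarrow> bool" where
  "is_prefix w u \<longleftrightarrow> occurs_at w u 0"

definition sturmian :: "'a stream \<Rightarrow> bool" where
  "sturmian u \<longleftrightarrow> (\<forall>n. card {w. is_factor w u \<and> length w = n} = n + 1)"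

definition right_special :: "'a list \<Rightarrow> 'a stream \<Rightarrow> bool" where
  "right_special v u \<longleftrightarrow> (\<exists>x y. x \<noteq> y \<and> is_factor (v @ [x]) u \<and> is_factor (v @ [y]) u)"

definition consecutive_occurrences :: "'a list \<Rightarrow> 'a stream \<Rightarrow> nat \<Rightarrow> nat \<Rightarrow> bool" where
  "consecutive_occurrences w u i j \<longleftrightarrow>
     i < j \<and> occurs_at w u i \<and> occurs_at w u j \<and> (\<forall>k. i < k \<and> k < j \<longrightarrow> \<not> occurs_at w u k)"

definition return_words :: "'a stream \<Rightarrow> 'a list \<Rightarrow> 'a list set" where
  "return_words u w = {stake (j - i) (sdrop i u) | i j. consecutive_occurrences w u i j}"

(* s is the derivated word of u with respect to w for some numbering r of the return words.
   A relation rather than a function, so that nothing is claimed about d_u(w) unless the return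
   words are finite in number and u factors over them. Return words are nonempty, so flat is
   the infinite concatenation. *)
definition derivated_word :: "'a stream \<Rightarrow> 'a list \<Rightarrow> nat stream \<Rightarrow> bool" where
  "derivated_word u w s \<longleftrightarrow>
     (\<exists>k r. bij_betw r {..<k} (return_words u w) \<and> sset s \<subseteq> {..<k} \<and> u = flat (smap r s))"

definition renaming :: "('a stream \<times> 'a stream) set" where
  "renaming = {(s, t). \<exists>p. inj_on p (sset s) \<and> t = smap p s}"

lemma equiv_renaming: "equiv UNIV (renaming :: ('a stream \<times> 'a stream) set)" (is "equiv _ ?R")
proof (rule equivI)
  show "refl ?R"
    by (auto simp: refl_on_def renaming_def stream.map_id intro!: exI[of _ id])
  show "sym ?R"
  proof (rule symI)
    fix s t :: "'a stream"
    assume "(s, t) \<in> renaming"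
    then obtain p where p: "inj_on p (sset s)" "t = smap p s"
      by (auto simp: renaming_def)
    have "smap (inv_into (sset s) p) t = smap id s"
      unfolding p(2) stream.map_comp
      by (rule stream.map_cong) (auto simp: p(1))
    moreover have "inj_on (inv_into (sset s) p) (sset t)"
      unfolding p(2) stream.set_map by (rule inj_on_inv_into) simp
    ultimately show "(t, s) \<in> renaming"
      unfolding renaming_def by (metis (mono_tags, lifting) case_prodI mem_Collect_eq stream.map_id)
  qed
  show "trans ?R"
  proof (rule transI)
    fix s t v :: "'a stream"
    assume "(s, t) \<in> renaming" "(t, v) \<in> renaming"
    then obtain p q where "inj_on p (sset s)" "t = smap p s" "inj_on q (sset t)" "v = smap q t"
      by (auto simp: renaming_def)
    then have "inj_on (q \<circ> p) (sset s) \<and> v = smap (q \<circ> p) s"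
      by (simp add: stream.map_comp stream.set_map comp_inj_on)
    then show "(s, v) \<in> renaming"
      unfolding renaming_def by blast
  qed
qed simp

(* Only nonempty prefixes count: for the empty word the return words are the letters and
   the derivated word is u itself, so including it would put u into Der u for every u. *)
definition Der :: "'a stream \<Rightarrow> nat stream set set" where
  "Der u = {s. \<exists>w. w \<noteq> [] \<and> is_prefix w u \<and> derivated_word u w s} // renaming"

definition phi_a :: "nat \<Rightarrow> nat list" where
  "phi_a x = (if x = 0 then [0] else [1, 0])"

end

(* Since 0 and 10 form a prefix code, an occurrence in u of the image of a word starting with 1 is the
   image of an occurrence in u'. Every nonempty prefix w of u is such an image, possibly after
   appending the 0 that always follows a final 1; so the return words to w are the images of the
   return words to w', and w and w' have literally the same derivated words.

   That derivated words exist at all rests on uniform recurrence, proved from the complexity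
   n + 1 alone. The unique right special factor rs n of length n occurs in every window, since
   otherwise the word would be eventually periodic. If some factor is missing from all rs n, their
   common left-infinite extension has too few factors, so it is periodic, which a comparison of
   the lengths of periodic runs in u excludes. *)

theory Submission
  imports Defs
begin

section \<open>Uniform recurrence of Sturmian words\<close>

definition fac :: "(nat \<Rightarrow> 'a) \<Rightarrow> nat \<Rightarrow> nat \<Rightarrow> 'a list" where
  "fac f i n = map f [i..<i + n]"

definition factors :: "(nat \<Rightarrow> 'a) \<Rightarrow> nat \<Rightarrow> 'a list set" where
  "factors f n = range (\<lambda>i. fac f i n)"

definition rspecs :: "(nat \<Rightarrow> 'a) \<Rightarrow> nat \<Rightarrow> 'a list set" where
  "rspecs f n = {v. \<exists>i j. fac f i n = v \<and> fac f j n = v \<and> f (i + n) \<noteq> f (j + n)}"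

definition eventually_periodic :: "(nat \<Rightarrow> 'a) \<Rightarrow> bool" where
  "eventually_periodic f \<longleftrightarrow> (\<exists>k p. p > 0 \<and> (\<forall>t\<ge>k. f (t + p) = f t))"

lemma length_fac [simp]: "length (fac f i n) = n"
  by (simp add: fac_def)

lemma nth_fac [simp]: "t < n \<Longrightarrow> fac f i n ! t = f (i + t)"
  by (simp add: fac_def)

lemma fac_eq_iff: "fac f i n = fac g j n \<longleftrightarrow> (\<forall>t<n. f (i + t) = g (j + t))"
  by (auto simp: list_eq_iff_nth_eq)

lemma fac_Suc: "fac f i (Suc n) = fac f i n @ [f (i + n)]"
  by (simp add: fac_def)

lemma fac_in_factors [simp]: "fac f i n \<in> factors f n"
  by (simp add: factors_def)

lemma fac_Suc_shift:
  assumes "fac f i n = fac f j n" "f (i + n) = f (j + n)"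
  shows "fac f (Suc i) n = fac f (Suc j) n"
  unfolding fac_eq_iff
proof (intro allI impI)
  fix t assume "t < n"
  then consider "Suc t < n" | "Suc t = n" by linarith
  then show "f (Suc i + t) = f (Suc j + t)"
  proof cases
    case 1
    then have "f (i + Suc t) = f (j + Suc t)" using assms(1) unfolding fac_eq_iff by blast
    then show ?thesis by simp
  next
    case 2
    then show ?thesis using assms(2) by auto
  qed
qed

text \<open>Each factor has at least one right extension and a right special one at least two. The
  maps \<open>e\<close> and \<open>e'\<close> choose these, so they yield disjoint families of
  factors of length \<open>Suc n\<close>.\<close>

lemma card_factors_Suc_ge:
  assumes fin: "finite (factors f (Suc n))"
  shows "finite (factors f n) \<and> card (factors f n) + card (rspecs f n) \<le> card (factors f (Suc n))"
proof -
  define pos where "pos v = (SOME i. fac f i n = v)" for v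
  define e where "e v = f (pos v + n)" for v
  define e' where "e' v = (SOME x. x \<noteq> e v \<and> v @ [x] \<in> factors f (Suc n))" for v
  have pos: "fac f (pos v) n = v" if v: "v \<in> factors f n" for v
    using v unfolding pos_def factors_def by (metis (mono_tags, lifting) imageE someI)
  have e: "v @ [e v] \<in> factors f (Suc n)" if "v \<in> factors f n" for v
    using pos[OF that] fac_in_factors[of f "pos v" "Suc n"] by (simp add: fac_Suc e_def)
  have e': "e' v \<noteq> e v \<and> v @ [e' v] \<in> factors f (Suc n)" if v: "v \<in> rspecs f n" for v
  proof -
    obtain i j where "fac f i n = v" "fac f j n = v" "f (i + n) \<noteq> f (j + n)"
      using v by (auto simp: rspecs_def)
    then have "\<exists>x. x \<noteq> e v \<and> v @ [x] \<in> factors f (Suc n)"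
      by (metis fac_Suc fac_in_factors)
    then show ?thesis unfolding e'_def by (rule someI_ex)
  qed
  let ?A = "(\<lambda>v. v @ [e v]) ` factors f n" and ?B = "(\<lambda>v. v @ [e' v]) ` rspecs f n"
  have sub: "?A \<union> ?B \<subseteq> factors f (Suc n)" using e e' by auto
  then have finAB: "finite ?A" "finite ?B" using fin finite_subset by blast+
  have inj: "inj_on (\<lambda>v. v @ [e v]) (factors f n)" "inj_on (\<lambda>v. v @ [e' v]) (rspecs f n)"
    by (auto intro: inj_onI)
  have "?A \<inter> ?B = {}" using e' by fastforce
  then have "card ?A + card ?B = card (?A \<union> ?B)" using finAB by (simp add: card_Un_disjoint)
  also have "\<dots> \<le> card (factors f (Suc n))" using sub fin by (rule card_mono[rotated])
  finally show ?thesis using inj finAB by (simp add: card_image finite_image_iff)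
qed

lemma rspecs_subset: "rspecs f n \<subseteq> factors f n"
  by (auto simp: rspecs_def)

text \<open>A factor that is not right special determines the next letter. Reading on from
  \<open>k\<close> and from \<open>l\<close> therefore stays in step, and the factors met are always
  among those already seen between \<open>k\<close> and \<open>l\<close>.\<close>

lemma eventually_periodic_if_no_rspec_between:
  assumes "k < l" "fac f k n = fac f l n" "\<forall>i\<in>{k..<l}. fac f i n \<notin> rspecs f n"
  shows "eventually_periodic f"
proof -
  have *: "fac f (k + t) n = fac f (l + t) n \<and> (\<exists>i\<in>{k..<l}. fac f i n = fac f (k + t) n)" for t
  proof (induction t)
    case 0
    show ?case using assms by auto
  next
    case (Suc t)
    then obtain i where i: "i \<in> {k..<l}" "fac f i n = fac f (k + t) n"
      and eq: "fac f (k + t) n = fac f (l + t) n" by blast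
    have next_eq: "f (i + n) = f (j + n)" if "fac f j n = fac f i n" for j
      using assms(3) i(1) that unfolding rspecs_def by (smt (verit) mem_Collect_eq)
    have "fac f (Suc (k + t)) n = fac f (Suc (l + t)) n"
      using eq next_eq[of "k + t"] next_eq[of "l + t"] i(2) by (intro fac_Suc_shift) auto
    moreover have "fac f (Suc i) n = fac f (Suc (k + t)) n"
      using next_eq[of "k + t"] i(2) by (intro fac_Suc_shift) auto
    \<comment> \<open>If \<open>Suc i\<close> leaves the window, it is \<open>l\<close>, and
      \<open>k\<close> carries the same factor.\<close>
    moreover have "\<exists>i'\<in>{k..<l}. fac f i' n = fac f (Suc i) n"
      using i(1) assms(1,2)
      by (metis Suc_leI atLeastLessThan_iff le_SucI le_neq_implies_less order_refl)
    ultimately show ?case by auto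
  qed
  have "f (t + (l - k)) = f t" if t: "t \<ge> k + n" for t
  proof -
    obtain s where s: "t = k + s + n" using le_Suc_ex[OF t] by (auto simp: algebra_simps)
    obtain i where i: "i \<in> {k..<l}" "fac f i n = fac f (k + s) n" "fac f (k + s) n = fac f (l + s) n"
      using * by metis
    have "f (k + s + n) = f (l + s + n)"
    proof (rule ccontr)
      assume "f (k + s + n) \<noteq> f (l + s + n)"
      then have "fac f i n \<in> rspecs f n" unfolding rspecs_def using i by force
      then show False using assms(3) i(1) by blast
    qed
    then show ?thesis using s assms(1) by (simp add: algebra_simps)
  qed
  then show ?thesis unfolding eventually_periodic_def using assms(1) by (meson zero_less_diff)
qed

text \<open>Moving back by the period brings every factor to a start below \<open>k + p\<close>,
  whatever its length.\<close>

lemma eventually_periodic_card_factors: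
  assumes "eventually_periodic f"
  shows "\<exists>C. \<forall>n. card (factors f n) \<le> C"
proof -
  obtain k p where p: "p > 0" and per: "\<And>t. t \<ge> k \<Longrightarrow> f (t + p) = f t"
    using assms by (auto simp: eventually_periodic_def)
  have rep: "\<exists>i'<k + p. fac f i' n = fac f i n" for i n
  proof (induction i rule: less_induct)
    case (less i)
    show ?case
    proof (cases "i < k + p")
      case False
      then obtain i' where i': "i' < k + p" "fac f i' n = fac f (i - p) n"
        using less.IH[of "i - p"] p by auto
      have "fac f (i - p) n = fac f i n"
        unfolding fac_eq_iff
      proof (intro allI impI)
        fix t
        show "f (i - p + t) = f (i + t)" using per[of "i - p + t"] False by (simp add: algebra_simps)
      qed
      then show ?thesis using i' by metis
    qed auto
  qed
  have "factors f n \<subseteq> (\<lambda>i. fac f i n) ` {..<k + p}" for n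
  proof
    fix v assume "v \<in> factors f n"
    then obtain i where "v = fac f i n" by (auto simp: factors_def)
    moreover obtain i' where "i' < k + p" "fac f i' n = fac f i n" using rep by blast
    ultimately show "v \<in> (\<lambda>i. fac f i n) ` {..<k + p}" by (metis imageI lessThan_iff)
  qed
  then have "card (factors f n) \<le> k + p" for n
    by (metis card_lessThan finite_lessThan surj_card_le)
  then show ?thesis by blast
qed

text \<open>Pigeonhole: among one more start than there are factors, two carry the same factor, and
  aperiodicity forces a right special factor between them.\<close>

lemma rspec_in_window:
  assumes np: "\<not> eventually_periodic f" and fin: "finite (factors f n)"
  shows "\<exists>j. i \<le> j \<and> j < i + card (factors f n) \<and> fac f j n \<in> rspecs f n"
proof -
  let ?c = "card (factors f n)"
  have "\<not> inj_on (\<lambda>i. fac f i n) {i..i + ?c}"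
  proof
    assume "inj_on (\<lambda>i. fac f i n) {i..i + ?c}"
    then have "card {i..i + ?c} \<le> ?c"
      by (rule card_inj_on_le) (auto simp: fin)
    then show False by simp
  qed
  then obtain k l where kl: "k < l" "i \<le> k" "l \<le> i + ?c" "fac f k n = fac f l n"
    unfolding inj_on_def by (metis atLeastAtMost_iff linorder_neqE_nat)
  then obtain j where "j \<in> {k..<l}" "fac f j n \<in> rspecs f n"
    using eventually_periodic_if_no_rspec_between np by blast
  then show ?thesis using kl by (intro exI[of _ j]) auto
qed

text \<open>Without eventual periodicity there is a right special factor of every length, so the
  complexity grows strictly.\<close>

lemma Morse_Hedlund:
  assumes np: "\<not> eventually_periodic f" and fin: "\<And>n. finite (factors f n)"
  shows "n + 1 \<le> card (factors f n)"
proof (induction n)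
  case 0
  have "factors f 0 \<noteq> {}" by (simp add: factors_def)
  then show ?case using fin[of 0] by (simp add: Suc_leI card_gt_0_iff)
next
  case (Suc n)
  have "rspecs f n \<noteq> {}" using rspec_in_window[OF np fin] by blast
  then have "card (rspecs f n) \<ge> 1"
    using fin[of n] rspecs_subset by (metis One_nat_def Suc_leI card_gt_0_iff finite_subset)
  then show ?case using Suc card_factors_Suc_ge[OF fin, of n] by linarith
qed

section \<open>Recurrence and the unique right special factors of a Sturmian sequence\<close>

locale sturmian_sequence =
  fixes f :: "nat \<Rightarrow> 'a"
  assumes complexity: "card (factors f n) = n + 1"
begin

text \<open>\<open>card\<close> is 0 on infinite sets, so a positive value gives finiteness.\<close>

lemma finite_factors: "finite (factors f n)"
  using complexity[of n] by (metis Suc_eq_plus1 card.infinite nat.distinct(1))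

lemma aperiodic: "\<not> eventually_periodic f"
proof
  assume "eventually_periodic f"
  then obtain C where "\<forall>n. card (factors f n) \<le> C" using eventually_periodic_card_factors by blast
  then have "card (factors f C) \<le> C" by blast
  then show False using complexity by simp
qed

text \<open>The tail from \<open>K\<close> is again aperiodic, hence has at least
  \<open>n + 1\<close> factors of length \<open>n\<close>. There are no more in all of
  \<open>f\<close>, so every factor of \<open>f\<close> occurs in the tail.\<close>

lemma recurrent: "\<exists>j\<ge>K. fac f j n = fac f i n"
proof -
  define g where "g t = f (K + t)" for t
  have fac_g: "fac g j m = fac f (K + j) m" for j m
    by (simp add: fac_eq_iff g_def algebra_simps)
  have sub: "factors g m \<subseteq> factors f m" for m
    by (auto simp: factors_def fac_g)
  have "\<not> eventually_periodic g"
  proof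
    assume "eventually_periodic g"
    then obtain k p where "p > 0" and per: "\<And>t. t \<ge> k \<Longrightarrow> g (t + p) = g t"
      by (auto simp: eventually_periodic_def)
    have "f (t + p) = f t" if "t \<ge> K + k" for t
      using per[of "t - K"] that by (simp add: g_def)
    then show False using aperiodic \<open>p > 0\<close> unfolding eventually_periodic_def by blast
  qed
  then have "n + 1 \<le> card (factors g n)"
    using sub finite_factors finite_subset by (metis Morse_Hedlund)
  then have "factors g n = factors f n"
    using sub finite_factors complexity by (metis card_seteq)
  then obtain j where "fac g j n = fac f i n"
    by (metis fac_in_factors factors_def imageE)
  then show ?thesis using fac_g by (metis le_add1)
qed

definition rs :: "nat \<Rightarrow> 'a list" where
  "rs n = (THE v. v \<in> rspecs f n)"

text \<open>The complexity grows by exactly one, which allows at most one right special factor;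
  aperiodicity provides one.\<close>

lemma rspecs_eq: "rspecs f n = {rs n}"
proof -
  have "card (rspecs f n) \<le> 1"
    using card_factors_Suc_ge[OF finite_factors, of n] complexity[of n] complexity[of "Suc n"] by linarith
  moreover have "finite (rspecs f n)" using finite_factors rspecs_subset finite_subset by metis
  moreover have "rspecs f n \<noteq> {}" using rspec_in_window[OF aperiodic finite_factors] by blast
  ultimately obtain v where v: "rspecs f n = {v}"
    by (metis One_nat_def card_1_singletonE card_0_eq le_SucE le_zero_eq)
  then show ?thesis by (simp add: rs_def)
qed

lemma rs_in_window: "\<exists>j. i \<le> j \<and> j \<le> i + n \<and> fac f j n = rs n"
  using rspec_in_window[OF aperiodic finite_factors, of i n] by (auto simp: rspecs_eq complexity less_Suc_eq_le)

lemma length_rs [simp]: "length (rs n) = n"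
  using rs_in_window by (metis length_fac)

lemma rs_eqI:
  assumes "fac f i n = fac f j n" "f (i + n) \<noteq> f (j + n)"
  shows "fac f i n = rs n"
proof -
  have "fac f i n \<in> rspecs f n"
    unfolding rspecs_def mem_Collect_eq using assms by (intro exI[of _ i] exI[of _ j]) simp
  then show ?thesis by (simp add: rspecs_eq)
qed

lemma rs_extensions:
  obtains i j where "fac f i n = rs n" "fac f j n = rs n" "f (i + n) \<noteq> f (j + n)"
proof -
  have "rs n \<in> rspecs f n" by (simp add: rspecs_eq)
  then show thesis unfolding rspecs_def mem_Collect_eq using that by blast
qed

text \<open>A suffix of a right special factor is right special, and there is only one of each
  length.\<close>

lemma tl_rs: "tl (rs (Suc n)) = rs n"
proof -
  obtain i j where ij: "fac f i (Suc n) = rs (Suc n)" "fac f j (Suc n) = rs (Suc n)"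
    "f (i + Suc n) \<noteq> f (j + Suc n)" by (rule rs_extensions)
  have tl: "tl (fac f k (Suc n)) = fac f (Suc k) n" for k
    by (simp add: list_eq_iff_nth_eq nth_tl)
  have "fac f (Suc i) n = fac f (Suc j) n" using ij tl by metis
  then have "fac f (Suc i) n = rs n" using ij(3) by (intro rs_eqI) auto
  then show ?thesis using tl ij by metis
qed

text \<open>The right special words are suffixes of one another; this is their common left-infinite
  extension, read from right to left.\<close>

definition \<rho> :: "nat \<Rightarrow> 'a" where
  "\<rho> i = hd (rs (Suc i))"

lemma nth_rs: "t < n \<Longrightarrow> rs n ! t = \<rho> (n - Suc t)"
proof (induction n arbitrary: t)
  case (Suc n)
  have ne: "rs (Suc n) \<noteq> []" by (metis length_rs list.size(3) nat.distinct(1))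
  then have "rs (Suc n) = \<rho> n # rs n"
    by (metis \<rho>_def list.collapse tl_rs)
  then show ?case using Suc by (cases t) auto
qed simp

lemma fac_eq_rs_iff: "fac f j n = rs n \<longleftrightarrow> (\<forall>t<n. f (j + t) = \<rho> (n - Suc t))"
  by (simp add: list_eq_iff_nth_eq nth_rs)

text \<open>This form uses absolute positions: within an occurrence of \<open>rs n\<close>, the
  index of \<open>\<rho>\<close> is the distance from the last letter.\<close>

lemma fac_rsD:
  assumes "fac f j n = rs n" "j \<le> x" "x < j + n"
  shows "f x = \<rho> (j + n - Suc x)"
proof -
  have "f (j + (x - j)) = \<rho> (n - Suc (x - j))"
    using assms by (intro fac_eq_rs_iff[THEN iffD1, rule_format]) auto
  moreover have "n - Suc (x - j) = j + n - Suc x" using assms by linarith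
  ultimately show ?thesis using assms(2) by simp
qed

end

section \<open>Excluding a periodic left-infinite extension\<close>

text \<open>Maximal runs of period \<open>p\<close> in \<open>f\<close> end at breaks. After a break preceded by a run of length
  \<open>N\<close>, the window bound for \<open>rs N\<close> leaves no room for anything but another run of length \<open>N\<close>;
  so all later runs are that long, and a shorter run could not recur.\<close>

locale periodic_right_special = sturmian_sequence +
  fixes p :: nat
  assumes p_pos: "p > 0" and \<rho>_period: "\<rho> (t + p) = \<rho> t"
begin

text \<open>For \<open>p \<le> N\<close> the letter \<open>\<rho> (p - 1)\<close> stands
  \<open>p\<close> places before \<open>b\<close>, so it is the one that would continue the period.
  The bound \<open>N \<le> b\<close> keeps \<open>b - N\<close> from being truncated.\<close>

definition brk :: "nat \<Rightarrow> nat \<Rightarrow> bool" where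
  "brk N b \<longleftrightarrow> N \<le> b \<and> fac f (b - N) N = rs N \<and> f b \<noteq> \<rho> (p - 1)"

lemma \<rho>_add_mult: "\<rho> (t + m * p) = \<rho> t"
proof (induction m)
  case (Suc m)
  have "t + Suc m * p = t + m * p + p" by simp
  then show ?case using Suc \<rho>_period by metis
qed simp

lemma rs_run_periodic:
  assumes "fac f j N = rs N" "j + p \<le> x" "x < j + N"
  shows "f x = f (x - p)"
proof -
  have "f (x - p) = \<rho> (j + N - Suc (x - p))" using assms by (intro fac_rsD) auto
  also have "j + N - Suc (x - p) = j + N - Suc x + p" using assms by linarith
  also have "\<rho> (j + N - Suc x + p) = \<rho> (j + N - Suc x)" by (rule \<rho>_period)
  also have "\<dots> = f x" using assms by (intro fac_rsD[symmetric]) auto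
  finally show ?thesis by simp
qed

lemma brk_run_periodic: "brk N b \<Longrightarrow> b - N + p \<le> x \<Longrightarrow> x < b \<Longrightarrow> f x = f (x - p)"
  using rs_run_periodic[of "b - N" N x] by (simp add: brk_def)

lemma brk_not_periodic:
  assumes "brk N b" "p \<le> N"
  shows "f b \<noteq> f (b - p)"
proof -
  have "f (b - p) = \<rho> (b - N + N - Suc (b - p))"
    using assms p_pos by (intro fac_rsD) (auto simp: brk_def)
  also have "b - N + N - Suc (b - p) = p - 1" using assms p_pos by (auto simp: brk_def)
  finally show ?thesis using assms by (auto simp: brk_def)
qed

text \<open>Of two different letters following \<open>rs N\<close>, one breaks the period;
  recurrence repeats that factor beyond any \<open>K\<close>.\<close>

lemma brk_arbitrarily_late: "\<exists>b\<ge>K. brk N b"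
proof -
  obtain i where i: "fac f i N = rs N" "f (i + N) \<noteq> \<rho> (p - 1)"
  proof -
    obtain i j where ij: "fac f i N = rs N" "fac f j N = rs N" "f (i + N) \<noteq> f (j + N)"
      by (rule rs_extensions)
    then show thesis using that[of i] that[of j] by (cases "f (i + N) = \<rho> (p - 1)") auto
  qed
  obtain j where "j \<ge> K" "fac f j (Suc N) = fac f i (Suc N)" using recurrent by blast
  then have "brk N (j + N)" using i by (auto simp: brk_def fac_Suc)
  then show ?thesis using \<open>j \<ge> K\<close> by (meson trans_le_add1)
qed

text \<open>The window for \<open>rs N\<close> is opened one place after the start of the run that
  ends at \<open>b\<close>. The occurrence found there cannot contain both \<open>b - p\<close> and
  \<open>b\<close>, since the period fails at \<open>b\<close>.\<close>

lemma brk_next_run: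
  assumes b: "brk N b" and N: "p \<le> N"
  obtains j where "b < j + p" "j \<le> Suc b" "fac f j N = rs N"
proof -
  obtain j where j: "Suc (b - N) \<le> j" "j \<le> Suc (b - N) + N" "fac f j N = rs N"
    using rs_in_window by blast
  have "N \<le> b" using b by (simp add: brk_def)
  have "b < j + p"
  proof (rule ccontr)
    assume "\<not> b < j + p"
    then have "f b = f (b - p)" using j \<open>N \<le> b\<close> by (intro rs_run_periodic[of j N]) auto
    then show False using brk_not_periodic b N by blast
  qed
  then show thesis using that j \<open>N \<le> b\<close> by auto
qed

text \<open>Prolonging an occurrence of \<open>rs N\<close> with period \<open>p\<close> may shift
  its phase, so the last \<open>N\<close> letters before \<open>b\<close> need not obviously be
  \<open>rs N\<close>. If the phase does shift, the same word also lies inside a longer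
  \<open>rs\<close>, where the next letter keeps the period; at \<open>b\<close> it does not. Hence
  the word is right special, and uniqueness identifies it.\<close>

lemma brk_end_of_run:
  assumes j: "fac f j N = rs N" and N: "p \<le> N" "j + N \<le> b"
    and run: "\<And>x. j + N \<le> x \<Longrightarrow> x < b \<Longrightarrow> f x = f (x - p)" and b: "f b \<noteq> f (b - p)"
  shows "brk N b"
proof -
  \<comment> \<open>Only the residue of \<open>y\<close> modulo \<open>p\<close> matters; the
    multiple \<open>m * p\<close> keeps \<open>y\<close> a natural number for \<open>x\<close>
    beyond the occurrence.\<close>
  have run': "f x = \<rho> y" if "j \<le> x" "x < b" "x + y = j + N - 1 + m * p" for x y m
    using that
  proof (induction x arbitrary: y m rule: less_induct)
    case (less x)
    show ?case
    proof (cases "x < j + N")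
      case True
      then have "f x = \<rho> (j + N - Suc x)" using j less.prems by (intro fac_rsD) auto
      moreover have "y = j + N - Suc x + m * p" using less.prems True by linarith
      ultimately show ?thesis by (simp add: \<rho>_add_mult)
    next
      case False
      have "f x = f (x - p)" using run False less.prems by simp
      also have "\<dots> = \<rho> (y + p)"
        using less.prems False N(1) p_pos by (intro less.IH[of _ _ m]) auto
      finally show ?thesis by (simp add: \<rho>_period)
    qed
  qed
  define D where "D = b - (j + N)"
  \<comment> \<open>\<open>E\<close> represents \<open>- D\<close> modulo \<open>p\<close>, the
    phase shift caused by prolonging the run by \<open>D\<close> letters.\<close>
  define E where "E = D * (p - 1)"
  have ED: "E + D = D * p" unfolding E_def using p_pos by (cases p) auto
  have bD: "b = j + N + D" using N by (simp add: D_def)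
  obtain i where i: "fac f i (N + (E + p)) = rs (N + (E + p))" using rs_in_window by blast
  have same: "fac f (b - N) N = fac f (i + p) N"
    unfolding fac_eq_iff
  proof (intro allI impI)
    fix t assume t: "t < N"
    have "f (i + p + t) = \<rho> (N + E - Suc t)"
      using fac_rsD[OF i, of "i + p + t"] t by (simp add: algebra_simps)
    moreover have "f (b - N + t) = \<rho> (N + E - Suc t)"
      using bD ED t by (intro run'[of _ _ D]) auto
    ultimately show "f (b - N + t) = f (i + p + t)" by simp
  qed
  \<comment> \<open>With \<open>E > 0\<close> the longer \<open>rs\<close> still has a letter after
    the copy of the word, namely \<open>\<rho> (E - 1)\<close>.\<close>
  have breaks: "f (i + p + N) \<noteq> f b" if "E > 0"
  proof -
    have "f (i + p + N) = \<rho> (E - 1)"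
      using fac_rsD[OF i, of "i + p + N"] that p_pos by (simp add: algebra_simps)
    also have "\<dots> = \<rho> (E - 1 + p)" by (simp add: \<rho>_period)
    also have "\<dots> = f (b - p)"
      using bD ED N that p_pos by (intro run'[of _ _ D, symmetric]) auto
    finally show ?thesis using b by simp
  qed
  have rsN: "fac f (b - N) N = rs N"
  proof (cases "E > 0")
    case True
    have "b - N + N = b" using bD by simp
    then have "f (b - N + N) \<noteq> f (i + p + N)" using breaks True by metis
    then show ?thesis using same by (intro rs_eqI)
  next
    case False
    show ?thesis unfolding fac_eq_rs_iff
    proof (intro allI impI)
      fix t assume "t < N"
      then show "f (b - N + t) = \<rho> (N - Suc t)"
        using bD ED False by (intro run'[of _ _ D]) auto
    qed
  qed
  have "f (b - p) = \<rho> (p - 1)"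
    using fac_rsD[OF rsN, of "b - p"] N p_pos by simp
  then show ?thesis using b rsN N by (simp add: brk_def)
qed

text \<open>Take breaks \<open>b0 < b1\<close> for runs of length \<open>M\<close>. The factor from
  \<open>b0 - p\<close> to \<open>b1\<close> is copied to a place after some break for runs of
  length \<open>L\<close>; its end \<open>c\<close> is a break for \<open>M\<close> but not for
  \<open>L\<close>. Yet from the last \<open>L\<close>-break before \<open>c\<close> the next run of
  length \<open>L\<close> leads to another \<open>L\<close>-break, at most \<open>c\<close>: a
  contradiction.\<close>

lemma impossible: False
proof -
  define M where "M = 2 * p"
  obtain b0 where b0: "brk M b0" using brk_arbitrarily_late by blast
  obtain b1 where b1: "b1 \<ge> Suc b0" "brk M b1" using brk_arbitrarily_late by blast
  have M_le: "M \<le> b0" "p \<le> M" using b0 by (auto simp: brk_def M_def)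
  have b0_break: "f b0 \<noteq> f (b0 - p)" using brk_not_periodic b0 M_le by blast
  \<comment> \<open>Otherwise the run before \<open>b1\<close> would contain both
    \<open>b0 - p\<close> and \<open>b0\<close>.\<close>
  have short: "b0 - p < b1 - M"
    using brk_run_periodic[OF b1(2), of b0] b0_break b1(1) M_le by fastforce
  \<comment> \<open>With this length a run ending at \<open>b1\<close> would start at
    \<open>b0 - p\<close> and so contradict the break at \<open>b0\<close>.\<close>
  define L where "L = b1 - b0 + p"
  have L: "M < L" "p < L" "b0 - p + L = b1"
    using short b1(1) M_le p_pos by (auto simp: L_def M_def)
  obtain b2 where b2: "brk L b2" using brk_arbitrarily_late by blast
  obtain c0 where c0: "c0 \<ge> Suc b2" "fac f c0 (Suc L) = fac f (b0 - p) (Suc L)"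
    using recurrent by blast
  have copy: "f (c0 + t) = f (b0 - p + t)" if "t \<le> L" for t
    using c0(2) that unfolding fac_eq_iff by auto
  define c where "c = c0 + L"
  have brk_c: "brk M c"
  proof -
    have "fac f (c - M) M = fac f (b1 - M) M"
      unfolding fac_eq_iff
    proof (intro allI impI)
      fix t assume t: "t < M"
      have "c - M + t = c0 + (L - M + t)" "b1 - M + t = b0 - p + (L - M + t)"
        using L by (auto simp: c_def)
      then show "f (c - M + t) = f (b1 - M + t)" using copy[of "L - M + t"] L t by simp
    qed
    moreover have "f c = f b1" using copy[of L] L by (simp add: c_def)
    ultimately show ?thesis using b1 L by (simp add: brk_def c_def)
  qed
  have not_brk_c: "\<not> brk L c"
  proof
    assume "brk L c"
    then have "f (c0 + p) = f c0" using brk_run_periodic[of L c "c0 + p"] L by (simp add: c_def)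
    then show False using copy[of 0] copy[of p] b0_break L M_le by simp
  qed
  define b where "b = (GREATEST b. brk L b \<and> b < c)"
  have "brk L b2 \<and> b2 < c" using b2 c0 by (simp add: c_def)
  then have b: "brk L b" "b < c"
    using GreatestI_nat[of "\<lambda>b. brk L b \<and> b < c" b2 c] by (auto simp: b_def)
  have b_greatest: "b' \<le> b" if "brk L b'" "b' < c" for b'
    using Greatest_le_nat[of "\<lambda>b. brk L b \<and> b < c" b' c] that by (auto simp: b_def)
  obtain j where j: "b < j + p" "j \<le> Suc b" "fac f j L = rs L"
    using brk_next_run b(1) L(2) less_imp_le by metis
  have c_break: "f c \<noteq> f (c - p)" using brk_not_periodic brk_c M_le by blast
  have b_break: "f b \<noteq> f (b - p)" using brk_not_periodic b L by simp
  have "L \<le> b" using b by (simp add: brk_def)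
  \<comment> \<open>Otherwise \<open>b\<close> is at most \<open>p\<close> places before
    \<open>c\<close>. As \<open>M\<close> is two periods, both \<open>b - p\<close> and
    \<open>b\<close> would then lie in the run before \<open>c\<close>.\<close>
  have "j + p \<le> c"
  proof (rule ccontr)
    assume "\<not> j + p \<le> c"
    then have "f b = f (b - p)"
      using j b brk_c L \<open>L \<le> b\<close> by (intro brk_run_periodic[of M c b]) (auto simp: M_def)
    then show False using b_break by simp
  qed
  then have c_ge: "j + L \<le> c"
    using rs_run_periodic[OF j(3)] c_break by (meson not_le)
  \<comment> \<open>The first failure of the period after the new run; \<open>c\<close> shows that
    there is one.\<close>
  define b' where "b' = (LEAST x. j + L \<le> x \<and> f x \<noteq> f (x - p))"
  have b': "j + L \<le> b'" "f b' \<noteq> f (b' - p)" "b' \<le> c"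
    using LeastI[of "\<lambda>x. j + L \<le> x \<and> f x \<noteq> f (x - p)" c]
      Least_le[of "\<lambda>x. j + L \<le> x \<and> f x \<noteq> f (x - p)" c] c_ge c_break
    by (auto simp: b'_def)
  have "f x = f (x - p)" if "j + L \<le> x" "x < b'" for x
    using not_less_Least[of x "\<lambda>x. j + L \<le> x \<and> f x \<noteq> f (x - p)"] that by (auto simp: b'_def)
  then have "brk L b'" using brk_end_of_run[OF j(3)] L b' by simp
  then show False
    using not_brk_c b_greatest[of b'] b' j L by (cases "b' = c") auto
qed

end

section \<open>From right special factors to uniform recurrence\<close>

context sturmian_sequence
begin

text \<open>Reversed factors of \<open>\<rho>\<close> are factors of \<open>f\<close>. If one factor
  of \<open>f\<close> were missing among them, Morse-Hedlund would make \<open>\<rho>\<close>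
  eventually periodic; it would even be purely periodic, which \<open>impossible\<close> rules
  out.\<close>

lemma factor_in_rs: "\<exists>N t. t + n \<le> N \<and> take n (drop t (rs N)) = fac f i n"
proof (rule ccontr)
  assume neg: "\<not> ?thesis"
  have rev_factor: "rev (fac \<rho> k m) = take m (rs (k + m))" for k m
  proof (rule nth_equalityI)
    fix t assume "t < length (rev (fac \<rho> k m))"
    then show "rev (fac \<rho> k m) ! t = take m (rs (k + m)) ! t"
      by (simp add: rev_nth nth_rs)
  qed simp
  have in_f: "take m (rs (k + m)) \<in> factors f m" for k m
  proof -
    obtain j where "fac f j (k + m) = rs (k + m)" using rs_in_window by blast
    then have "fac f j m = take m (rs (k + m))" by (metis le_add2 fac_def take_map take_upt nat_add_left_cancel_le)
    then show ?thesis by (metis fac_in_factors)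
  qed
  have img: "rev ` factors \<rho> m \<subseteq> factors f m" for m
    unfolding factors_def[of \<rho>] using rev_factor in_f by auto
  have "fac f i n \<notin> rev ` factors \<rho> n"
  proof
    assume "fac f i n \<in> rev ` factors \<rho> n"
    then obtain k where "fac f i n = take n (drop 0 (rs (k + n)))"
      unfolding factors_def using rev_factor by auto
    then show False using neg by (metis add_0 le_add2)
  qed
  then have "rev ` factors \<rho> n \<subset> factors f n" using img by auto
  then have "card (factors \<rho> n) < n + 1"
    using psubset_card_mono[OF finite_factors] complexity
    by (metis card_image inj_on_rev)
  moreover have "finite (factors \<rho> m)" for m
    using img finite_factors by (metis finite_imageD finite_subset inj_on_rev)
  ultimately have "eventually_periodic \<rho>" using Morse_Hedlund by (metis not_le)
  then obtain k p where p: "p > 0" and per: "\<And>t. t \<ge> k \<Longrightarrow> \<rho> (t + p) = \<rho> t"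
    by (auto simp: eventually_periodic_def)
  \<comment> \<open>An occurrence of \<open>rs N\<close> near the left end of \<open>rs M\<close>
    repeats the first \<open>N\<close> letters of \<open>\<rho>\<close> at an index
    \<open>d \<ge> k\<close>, where the period already holds.\<close>
  have "\<rho> (t + p) = \<rho> t" for t
  proof -
    define N where "N = t + p + 1"
    define M where "M = k + 2 * N"
    obtain j where j: "fac f j M = rs M" using rs_in_window by blast
    obtain j' where j': "j \<le> j'" "j' \<le> j + N" "fac f j' N = rs N" using rs_in_window by blast
    define d where "d = j + M - N - j'"
    have d: "d \<ge> k" using j' by (simp add: d_def M_def)
    have shift: "\<rho> s = \<rho> (d + s)" if "s < N" for s
    proof -
      have "f (j' + (N - 1 - s)) = \<rho> s" using fac_rsD[OF j'(3), of "j' + (N - 1 - s)"] that by simp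
      moreover have "f (j' + (N - 1 - s)) = \<rho> (j + M - Suc (j' + (N - 1 - s)))"
        using j' that by (intro fac_rsD[OF j]) (auto simp: M_def)
      moreover have "j + M - Suc (j' + (N - 1 - s)) = d + s"
        using j' that by (auto simp: d_def M_def)
      ultimately show ?thesis by simp
    qed
    show ?thesis using shift[of t] shift[of "t + p"] per[of "d + t"] d by (simp add: N_def add.assoc)
  qed
  then interpret periodic_right_special f p using p by unfold_locales
  show False by (rule impossible)
qed

text \<open>The factor lies in some \<open>rs N\<close>, and \<open>rs N\<close> starts in every
  window of \<open>N + 1\<close> positions.\<close>

lemma uniformly_recurrent: "\<exists>G. \<forall>k. \<exists>j. k \<le> j \<and> j \<le> k + G \<and> fac f j n = fac f i n"
proof -
  obtain N t where Nt: "t + n \<le> N" "take n (drop t (rs N)) = fac f i n" using factor_in_rs by blast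
  have "\<exists>j. k \<le> j \<and> j \<le> k + 2 * N \<and> fac f j n = fac f i n" for k
  proof -
    obtain j where j: "k \<le> j" "j \<le> k + N" "fac f j N = rs N" using rs_in_window by blast
    have "take n (drop t (fac f j N)) = fac f (j + t) n"
      using Nt(1) by (auto simp: list_eq_iff_nth_eq add.assoc)
    then show ?thesis using j Nt by (intro exI[of _ "j + t"]) auto
  qed
  then show ?thesis by blast
qed

end

section \<open>Existence of derivated words\<close>

lemma stake_sdrop_eq_fac: "stake n (sdrop i u) = fac ((!!) u) i n"
  by (simp add: list_eq_iff_nth_eq sdrop_snth)

lemma occurs_at_iff_fac: "occurs_at w u i \<longleftrightarrow> fac ((!!) u) i (length w) = w"
  by (simp add: occurs_at_def stake_sdrop_eq_fac)

lemma sturmian_sequence_snth: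
  assumes "sturmian u"
  shows "sturmian_sequence ((!!) u)"
proof
  fix n
  have "{w. is_factor w u \<and> length w = n} = factors ((!!) u) n"
    by (auto simp: is_factor_def occurs_at_iff_fac factors_def image_iff) (metis length_fac)
  then show "card (factors ((!!) u) n) = n + 1"
    using assms unfolding sturmian_def by metis
qed

lemma occurs_at_append1: "occurs_at (w @ [x]) u i \<longleftrightarrow> occurs_at w u i \<and> u !! (i + length w) = x"
  by (auto simp: occurs_at_iff_fac fac_Suc)

lemma stream_eq_nth: "s = t \<longleftrightarrow> (\<forall>n. s !! n = t !! n)"
  using smap_alt[of id s t] by (simp add: stream.map_id)

text \<open>With \<open>P\<close> as being an occurrence and \<open>nxt\<close> as the next
  occurrence, this is the factorization into return words. Each block is nonempty, so induction on
  the letter position works.\<close>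

lemma flat_smap_siterate_gaps:
  assumes step: "\<And>i. P i \<Longrightarrow> P (nxt i) \<and> i < nxt i" and "P i"
  shows "flat (smap (\<lambda>i. stake (nxt i - i) (sdrop i u)) (siterate nxt i)) = sdrop i u"
proof -
  let ?g = "\<lambda>i. stake (nxt i - i) (sdrop i u)"
  have "flat (smap ?g (siterate nxt i)) !! m = sdrop i u !! m" if "P i" for m i
    using that
  proof (induction m arbitrary: i rule: less_induct)
    case (less m)
    have nxt: "P (nxt i)" "i < nxt i" using step less.prems by auto
    have eq: "flat (smap ?g (siterate nxt i)) = ?g i @- flat (smap ?g (siterate nxt (nxt i)))"
      using nxt by (subst siterate.code) simp
    show ?case
    proof (cases "m < nxt i - i")
      case True
      then show ?thesis by (simp add: eq shift_snth)
    next
      case False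
      then show ?thesis
        using nxt less.IH[of "m - (nxt i - i)" "nxt i"] by (simp add: eq shift_snth sdrop_snth add.commute)
    qed
  qed
  then show ?thesis using assms(2) by (auto simp: stream_eq_nth)
qed

text \<open>Bounded gaps bound the length of return words, and the alphabet is finite.\<close>

lemma finite_return_words:
  assumes "finite (sset u)" and gap: "\<And>k. \<exists>j. k \<le> j \<and> j \<le> k + G \<and> occurs_at w u j"
  shows "finite (return_words u w)"
proof (rule finite_subset)
  show "return_words u w \<subseteq> {v. set v \<subseteq> sset u \<and> length v \<le> Suc G}"
  proof
    fix v assume "v \<in> return_words u w"
    then obtain i j where v: "v = stake (j - i) (sdrop i u)" and ij: "consecutive_occurrences w u i j"
      by (auto simp: return_words_def)
    obtain k where "Suc i \<le> k" "k \<le> Suc i + G" "occurs_at w u k" using gap by blast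
    then have "j \<le> Suc i + G" using ij unfolding consecutive_occurrences_def
      by (meson Suc_le_lessD le_trans not_le)
    moreover have "set v \<subseteq> sset u"
      by (auto simp: v stake_sdrop_eq_fac fac_def)
    ultimately show "v \<in> {v. set v \<subseteq> sset u \<and> length v \<le> Suc G}" by (simp add: v)
  qed
  show "finite {v. set v \<subseteq> sset u \<and> length v \<le> Suc G}"
    using assms(1) by (rule finite_lists_length_le)
qed

text \<open>Uniform recurrence makes the next occurrence well defined and the return words finite in
  number. The occurrences are visited from position 0, which is one because \<open>w\<close> is a
  prefix.\<close>

lemma derivated_word_exists:
  assumes "sturmian u" "finite (sset u)" "is_prefix w u"
  shows "\<exists>s. derivated_word u w s"
proof -
  interpret sturmian_sequence "(!!) u" by (rule sturmian_sequence_snth) fact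
  have w: "fac ((!!) u) 0 (length w) = w"
    using assms(3) by (simp add: is_prefix_def occurs_at_iff_fac)
  obtain G where "\<forall>k. \<exists>j. k \<le> j \<and> j \<le> k + G \<and> fac ((!!) u) j (length w) = fac ((!!) u) 0 (length w)"
    using uniformly_recurrent by blast
  then have gap: "\<exists>j. k \<le> j \<and> j \<le> k + G \<and> occurs_at w u j" for k
    unfolding occurs_at_iff_fac w by blast
  define nxt where "nxt i = (LEAST j. i < j \<and> occurs_at w u j)" for i
  have nxt: "i < nxt i \<and> occurs_at w u (nxt i)" for i
  proof -
    obtain j where "i < j \<and> occurs_at w u j" using gap[of "Suc i"] Suc_le_lessD by blast
    then show ?thesis unfolding nxt_def by (rule LeastI)
  qed
  have consecutive: "consecutive_occurrences w u i (nxt i)" if "occurs_at w u i" for i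
  proof -
    have "\<not> occurs_at w u j" if "i < j" "j < nxt i" for j
      using not_less_Least that unfolding nxt_def by blast
    then show ?thesis using nxt that unfolding consecutive_occurrences_def by blast
  qed
  define g where "g i = stake (nxt i - i) (sdrop i u)" for i
  obtain r where r: "bij_betw r {..<card (return_words u w)} (return_words u w)"
    using ex_bij_betw_nat_finite[OF finite_return_words[OF assms(2) gap]]
    by (auto simp: atLeast0LessThan)
  \<comment> \<open>Each visited occurrence is replaced by the number of the return word starting
    there.\<close>
  define s where "s = smap (inv_into {..<card (return_words u w)} r \<circ> g) (siterate nxt 0)"
  have occ: "occurs_at w u i" if i: "i \<in> sset (siterate nxt 0)" for i
  proof -
    obtain m where "i = (nxt ^^ m) 0" using i unfolding sset_siterate by blast
    then show ?thesis using nxt assms(3) by (cases m) (auto simp: is_prefix_def)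
  qed
  have g: "g i \<in> return_words u w" if "i \<in> sset (siterate nxt 0)" for i
    using consecutive[OF occ[OF that]] by (auto simp: return_words_def g_def)
  have "smap r s = smap g (siterate nxt 0)"
    unfolding s_def stream.map_comp
  proof (rule stream.map_cong)
    fix i assume "i \<in> sset (siterate nxt 0)"
    then show "(r \<circ> (inv_into {..<card (return_words u w)} r \<circ> g)) i = g i"
      using bij_betw_inv_into_right[OF r] g by simp
  qed simp
  moreover have "flat (smap g (siterate nxt 0)) = sdrop 0 u"
    unfolding g_def using nxt assms(3)
    by (intro flat_smap_siterate_gaps[of "occurs_at w u"]) (auto simp: is_prefix_def)
  ultimately have "u = flat (smap r s)" by simp
  moreover have "sset s \<subseteq> {..<card (return_words u w)}"
  proof
    fix x assume "x \<in> sset s"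
    then obtain i where "i \<in> sset (siterate nxt 0)"
      "x = inv_into {..<card (return_words u w)} r (g i)" by (auto simp: s_def stream.set_map)
    then show "x \<in> {..<card (return_words u w)}"
      using g r by (metis bij_betw_imp_surj_on inv_into_into)
  qed
  ultimately show ?thesis unfolding derivated_word_def using r by blast
qed

section \<open>Return words and the substitution\<close>

abbreviation phi :: "nat list \<Rightarrow> nat list" where
  "phi w \<equiv> concat (map phi_a w)"

abbreviation Phi :: "nat stream \<Rightarrow> nat stream" where
  "Phi s \<equiv> flat (smap phi_a s)"

lemma phi_a_0 [simp]: "phi_a 0 = [0]"
  by (simp add: phi_a_def)

lemma phi_a_nonzero: "x \<noteq> 0 \<Longrightarrow> phi_a x = [1, 0]"
  by (simp add: phi_a_def)

lemma phi_a_nonempty [simp]: "phi_a x \<noteq> []"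
  by (simp add: phi_a_def)

lemma Phi_Stream [simp]: "flat (phi_a x ## smap phi_a s) = phi_a x @- Phi s"
  by simp

lemma Phi_shift: "Phi (w @- s) = phi w @- Phi s"
  by (induction w) simp_all

lemma Phi_sdrop: "sdrop (length (phi (stake k s))) (Phi s) = Phi (sdrop k s)"
proof -
  have "Phi s = phi (stake k s) @- Phi (sdrop k s)"
    by (metis Phi_shift stake_sdrop)
  then show ?thesis by (metis sdrop_shift drop_all order_refl diff_self_eq_0 shift.simps(1) sdrop.simps(1))
qed

text \<open>The words \<open>0\<close> and \<open>10\<close> form a prefix code.\<close>

lemma stake_Phi_iff:
  "set w \<subseteq> {0, 1} \<Longrightarrow> sset s \<subseteq> {0, 1} \<Longrightarrow>
    stake (length (phi w)) (Phi s) = phi w \<longleftrightarrow> stake (length w) s = w"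
proof (induction w arbitrary: s)
  case (Cons x w)
  obtain y s' where s: "s = y ## s'" by (cases s)
  have "y \<in> {0, 1}" "sset s' \<subseteq> {0, 1}" "x \<in> {0, 1}" "set w \<subseteq> {0, 1}"
    using Cons.prems by (auto simp: s)
  then show ?case using Cons.IH[of s'] by (auto simp: s phi_a_def)
qed simp

lemma stake_eqI: "(\<And>n. stake n s = stake n t) \<Longrightarrow> s = t"
  unfolding stream_eq_nth by (metis lessI stake_nth)

lemma set_stake_subset: "set (stake n (sdrop i s)) \<subseteq> sset s"
  by (auto simp: stake_sdrop_eq_fac fac_def)

text \<open>Unique decoding of every finite prefix determines the whole stream.\<close>

lemma Phi_inject:
  assumes "sset s \<subseteq> {0, 1}" "sset t \<subseteq> {0, 1}" "Phi s = Phi t"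
  shows "s = t"
proof (rule stake_eqI)
  fix n
  have set: "set (stake n s) \<subseteq> {0, 1}" using set_stake_subset[of n 0 s] assms(1) by auto
  have "stake (length (phi (stake n s))) (Phi t) = phi (stake n s)"
    using stake_Phi_iff[OF set assms(1)] assms(3) by simp
  then show "stake n s = stake n t" using stake_Phi_iff[OF set assms(2)] by simp
qed

text \<open>The restriction to binary words matters: \<open>phi_a\<close> sends all nonzero letters
  to the same block.\<close>

lemma inj_on_phi: "inj_on phi {w. set w \<subseteq> {0, 1}}"
proof (rule inj_onI, unfold mem_Collect_eq)
  fix v w
  show "set v \<subseteq> {0, 1} \<Longrightarrow> set w \<subseteq> {0, 1} \<Longrightarrow> phi v = phi w \<Longrightarrow> v = w"
  proof (induction v arbitrary: w)
    case Nil
    then show ?case by (cases w) auto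
  next
    case (Cons x v)
    then show ?case by (cases w) (auto simp: phi_a_def split: if_splits)
  qed
qed

section \<open>Block boundaries, occurrences and return words in the image\<close>

definition pos :: "nat stream \<Rightarrow> nat \<Rightarrow> nat" where
  "pos s k = length (phi (stake k s))"

lemma sdrop_pos: "sdrop (pos s k) (Phi s) = Phi (sdrop k s)"
  by (simp add: pos_def Phi_sdrop)

lemma pos_0 [simp]: "pos s 0 = 0"
  by (simp add: pos_def)

lemma pos_add: "pos s (k + m) = pos s k + length (phi (stake m (sdrop k s)))"
  by (simp add: pos_def stake_add[symmetric] del: stake_add)

lemma pos_Suc: "pos s (Suc k) = pos s k + length (phi_a (s !! k))"
  by (simp add: pos_def stake_Suc del: stake.simps)

lemma strict_mono_pos: "strict_mono (pos s)"
  by (simp add: strict_mono_Suc_iff pos_Suc)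

lemma pos_less_iff: "pos s k < pos s l \<longleftrightarrow> k < l"
  by (rule strict_mono_less[OF strict_mono_pos])

lemma Phi_snth_pos: "Phi s !! pos s k = hd (phi_a (s !! k))"
proof -
  have "Phi s !! pos s k = shd (Phi (sdrop k s))"
    by (metis sdrop_pos sdrop_simps(1))
  also have "\<dots> = hd (phi_a (s !! k))"
    by (subst flat_unfold) simp_all
  finally show ?thesis .
qed

text \<open>In the blocks 0 and 10 a letter 1 can only come first. The induction strips the first
  block.\<close>

lemma Phi_snth_1D:
  "Phi s !! i = 1 \<Longrightarrow> \<exists>k. i = pos s k \<and> s !! k \<noteq> 0"
proof (induction i arbitrary: s rule: less_induct)
  case (less i)
  obtain y s' where s: "s = y ## s'" by (cases s)
  have pos: "pos s (Suc k) = length (phi_a y) + pos s' k" for k by (simp add: pos_def s)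
  have Phi: "Phi s = phi_a y @- Phi s'" by (simp add: s)
  show ?case
  proof (cases "i < length (phi_a y)")
    case True
    then have "i = 0 \<and> y \<noteq> 0"
      using less.prems[unfolded Phi] by (auto simp: phi_a_def less_Suc_eq split: if_splits)
    then show ?thesis by (intro exI[of _ 0]) (simp add: s)
  next
    case False
    then have "Phi s' !! (i - length (phi_a y)) = 1" using less.prems[unfolded Phi] by simp
    then obtain k where "i - length (phi_a y) = pos s' k" "s' !! k \<noteq> 0"
      using less.IH[of "i - length (phi_a y)" s'] False
      by (metis diff_less length_greater_0_conv less_le_trans not_less phi_a_nonempty)
    then show ?thesis using False by (intro exI[of _ "Suc k"]) (simp add: pos, simp add: s)
  qed
qed

lemma Phi_snth_Suc: "Phi s !! i = 1 \<Longrightarrow> Phi s !! Suc i = 0"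
proof -
  assume "Phi s !! i = 1"
  then obtain k where k: "i = pos s k" "s !! k \<noteq> 0" using Phi_snth_1D by blast
  have "Phi s !! Suc i = Phi (sdrop k s) !! 1"
    using sdrop_snth[of i "Phi s" 1] by (simp add: k(1) sdrop_pos)
  also have "\<dots> = 0"
    using k(2) by (subst flat_unfold) (simp_all add: phi_a_def)
  finally show ?thesis .
qed

lemma sset_sdrop_subset: "sset (sdrop k s) \<subseteq> sset s"
proof
  fix x assume "x \<in> sset (sdrop k s)"
  then obtain m where "x = s !! (k + m)" by (auto simp: sset_range sdrop_snth)
  then show "x \<in> sset s" by simp
qed

text \<open>The image starts with 1, so each occurrence begins at a block boundary, where the prefix
  code can be decoded.\<close>

lemma occurs_at_phi_iff:
  assumes s: "sset s \<subseteq> {0, 1}" and w: "set w \<subseteq> {0, 1}" "w \<noteq> []" "hd w = 1"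
  shows "occurs_at (phi w) (Phi s) i \<longleftrightarrow> (\<exists>k. i = pos s k \<and> occurs_at w s k)"
proof -
  have *: "occurs_at (phi w) (Phi s) (pos s k) \<longleftrightarrow> occurs_at w s k" for k
    unfolding occurs_at_def sdrop_pos
    using sset_sdrop_subset[of k s] s by (intro stake_Phi_iff[OF w(1)]) simp
  have "\<exists>k. i = pos s k" if occ: "occurs_at (phi w) (Phi s) i"
  proof -
    obtain w' where "w = 1 # w'" using w by (cases w) auto
    then have "phi w \<noteq> []" "phi w ! 0 = 1" by (simp_all add: phi_a_def)
    then have "Phi s !! i = 1"
      using occ unfolding occurs_at_iff_fac by (metis nth_fac add_0_right length_greater_0_conv)
    then show ?thesis using Phi_snth_1D by blast
  qed
  then show ?thesis using * by blast
qed

text \<open>The strictly increasing \<open>pos s\<close> matches the occurrences of \<open>w\<close>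
  with those of \<open>phi w\<close>, so consecutive ones correspond.\<close>

lemma return_words_phi:
  assumes s: "sset s \<subseteq> {0, 1}" and w: "set w \<subseteq> {0, 1}" "w \<noteq> []" "hd w = 1"
  shows "return_words (Phi s) (phi w) = phi ` return_words s w"
proof -
  note occ = occurs_at_phi_iff[OF assms]
  have pos_eq: "pos s k = pos s l \<longleftrightarrow> k = l" for k l
    by (rule strict_mono_eq[OF strict_mono_pos])
  have cons: "consecutive_occurrences (phi w) (Phi s) (pos s k) (pos s l)
      \<longleftrightarrow> consecutive_occurrences w s k l" for k l
  proof -
    have "(\<forall>m. pos s k < m \<and> m < pos s l \<longrightarrow> \<not> (\<exists>n. m = pos s n \<and> occurs_at w s n))
        \<longleftrightarrow> (\<forall>n. k < n \<and> n < l \<longrightarrow> \<not> occurs_at w s n)"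
      using pos_less_iff by metis
    then show ?thesis unfolding consecutive_occurrences_def occ by (simp add: pos_less_iff pos_eq)
  qed
  have word: "stake (pos s l - pos s k) (sdrop (pos s k) (Phi s)) = phi (stake (l - k) (sdrop k s))"
    if "k < l" for k l
  proof -
    have len: "pos s l - pos s k = length (phi (stake (l - k) (sdrop k s)))"
      using pos_add[of s k "l - k"] that by simp
    have "Phi (sdrop k s) = phi (stake (l - k) (sdrop k s)) @- Phi (sdrop (l - k) (sdrop k s))"
      by (metis Phi_shift stake_sdrop)
    then show ?thesis unfolding sdrop_pos len by (simp add: stake_shift)
  qed
  show ?thesis
  proof (intro equalityI subsetI)
    fix v assume "v \<in> return_words (Phi s) (phi w)"
    then obtain i j where v: "v = stake (j - i) (sdrop i (Phi s))"
      and ij: "consecutive_occurrences (phi w) (Phi s) i j" by (auto simp: return_words_def)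
    obtain k l where "i = pos s k" "j = pos s l"
      using ij unfolding consecutive_occurrences_def occ by blast
    then show "v \<in> phi ` return_words s w"
      using v ij cons word unfolding return_words_def consecutive_occurrences_def by blast
  next
    fix v assume "v \<in> phi ` return_words s w"
    then obtain k l where v: "v = phi (stake (l - k) (sdrop k s))"
      and kl: "consecutive_occurrences w s k l" by (auto simp: return_words_def)
    then have "v = stake (pos s l - pos s k) (sdrop (pos s k) (Phi s))"
      using word by (simp add: consecutive_occurrences_def)
    then show "v \<in> return_words (Phi s) (phi w)"
      using kl cons unfolding return_words_def by blast
  qed
qed

section \<open>Derivated words and right special factors under the substitution\<close>

lemma Phi_flat:
  assumes "\<And>x. x \<in> sset t \<Longrightarrow> r x \<noteq> []"
  shows "flat (smap (\<lambda>x. phi (r x)) t) = Phi (flat (smap r t))"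
proof -
  have "flat (smap (\<lambda>x. phi (r x)) t) !! m = Phi (flat (smap r t)) !! m"
    if "\<And>x. x \<in> sset t \<Longrightarrow> r x \<noteq> []" for m t
    using that
  proof (induction m arbitrary: t rule: less_induct)
    case (less m)
    obtain x t' where t: "t = x ## t'" by (cases t)
    have r: "r x \<noteq> []" "phi (r x) \<noteq> []" using less.prems[of x] by (cases "r x"; simp add: t)+
    have L: "flat (smap (\<lambda>x. phi (r x)) t) = phi (r x) @- flat (smap (\<lambda>x. phi (r x)) t')"
      using r by (simp add: t)
    have R: "Phi (flat (smap r t)) = phi (r x) @- Phi (flat (smap r t'))"
      using r by (simp add: t Phi_shift del: smap_shift)
    have len: "length (phi (r x)) > 0" using r by blast
    show ?case
    proof (cases "m < length (phi (r x))")
      case True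
      then show ?thesis by (simp only: L R shift_snth_less)
    next
      case False
      then have "m - length (phi (r x)) < m" using len by linarith
      then have "flat (smap (\<lambda>x. phi (r x)) t') !! (m - length (phi (r x)))
          = Phi (flat (smap r t')) !! (m - length (phi (r x)))"
        using less.prems by (intro less.IH) (simp_all add: t)
      then show ?thesis using False by (simp only: L R shift_snth if_False)
    qed
  qed
  then show ?thesis using assms by (auto simp: stream_eq_nth)
qed

lemma return_words_nonempty: "[] \<notin> return_words u w"
proof
  assume "[] \<in> return_words u w"
  then obtain i j where "[] = stake (j - i) (sdrop i u)" "i < j"
    unfolding return_words_def consecutive_occurrences_def by blast
  then show False using length_stake[of "j - i" "sdrop i u"] by simp
qed

lemma sset_flat_subset:
  assumes "\<And>x. x \<in> sset t \<Longrightarrow> r x \<noteq> [] \<and> set (r x) \<subseteq> A"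
  shows "sset (flat (smap r t)) \<subseteq> A"
  using assms by (subst sset_flat) (auto simp: stream.set_map)

text \<open>Composition with the bijection \<open>phi\<close> turns numberings of one set of return
  words into numberings of the other, and injectivity of \<open>Phi\<close> transfers the
  factorization. The word \<open>t\<close> itself stays the same.\<close>

lemma derivated_word_phi_iff:
  assumes s: "sset s \<subseteq> {0, 1}"
    and ret: "return_words (Phi s) v = phi ` return_words s w"
  shows "derivated_word (Phi s) v t \<longleftrightarrow> derivated_word s w t"
proof -
  let ?R = "return_words s w"
  have R: "?R \<subseteq> {w. set w \<subseteq> {0, 1}}"
    using set_stake_subset s by (fastforce simp: return_words_def)
  have phi: "bij_betw phi ?R (phi ` ?R)"
    using inj_on_subset[OF inj_on_phi R] by (rule inj_on_imp_bij_betw)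
  have key: "Phi s = flat (smap (phi \<circ> r) t) \<longleftrightarrow> s = flat (smap r t)"
    if r: "bij_betw r {..<k} ?R" and t: "sset t \<subseteq> {..<k}" for r k
  proof -
    have r': "r x \<noteq> [] \<and> set (r x) \<subseteq> {0, 1}" if "x \<in> sset t" for x
    proof -
      have "r x \<in> ?R" using that t bij_betwE[OF r] by blast
      then show ?thesis using R return_words_nonempty by (metis mem_Collect_eq subsetD)
    qed
    have "flat (smap (phi \<circ> r) t) = Phi (flat (smap r t))"
      using Phi_flat[of t r] r' by (simp add: comp_def)
    moreover have "sset (flat (smap r t)) \<subseteq> {0, 1}" using r' by (rule sset_flat_subset)
    ultimately show ?thesis using Phi_inject[OF s] by metis
  qed
  show ?thesis
  proof
    assume "derivated_word (Phi s) v t"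
    then obtain k r where r: "bij_betw r {..<k} (phi ` ?R)" "sset t \<subseteq> {..<k}"
      "Phi s = flat (smap r t)" by (auto simp: derivated_word_def ret)
    define r' where "r' = inv_into ?R phi \<circ> r"
    have r': "bij_betw r' {..<k} ?R"
      unfolding r'_def using r(1) bij_betw_inv_into[OF phi] by (rule bij_betw_trans)
    have "smap (phi \<circ> r') t = smap r t"
    proof (rule stream.map_cong)
      fix x assume "x \<in> sset t"
      then have "r x \<in> phi ` ?R" using r bij_betwE by blast
      then show "(phi \<circ> r') x = r x" using f_inv_into_f[of "r x" phi ?R] by (simp add: r'_def)
    qed simp
    then show "derivated_word s w t"
      using key[OF r' r(2)] r r' by (auto simp: derivated_word_def)
  next
    assume "derivated_word s w t"
    then obtain k r where r: "bij_betw r {..<k} ?R" "sset t \<subseteq> {..<k}" "s = flat (smap r t)"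
      by (auto simp: derivated_word_def)
    then show "derivated_word (Phi s) v t"
      unfolding derivated_word_def ret
      using key[OF r(1,2)] bij_betw_trans[OF r(1) phi] by blast
  qed
qed

text \<open>The letter after \<open>phi w\<close> begins the next block, so two different such
  letters come from two different letters after \<open>w\<close>.\<close>

lemma right_special_phiD:
  assumes s: "sset s \<subseteq> {0, 1}" and w: "set w \<subseteq> {0, 1}" "w \<noteq> []" "hd w = 1"
    and rsp: "right_special (phi w) (Phi s)"
  shows "right_special w s"
proof -
  have *: "\<exists>y. x = hd (phi_a y) \<and> is_factor (w @ [y]) s" if fac: "is_factor (phi w @ [x]) (Phi s)" for x
  proof -
    obtain i where i: "occurs_at (phi w) (Phi s) i" "Phi s !! (i + length (phi w)) = x"
      using fac by (auto simp: is_factor_def occurs_at_append1)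
    then obtain k where k: "i = pos s k" "occurs_at w s k"
      using occurs_at_phi_iff[OF s w] by blast
    have "i + length (phi w) = pos s (k + length w)"
      using k by (simp add: pos_add occurs_at_def)
    then have "x = hd (phi_a (s !! (k + length w)))" using i(2) by (simp only: Phi_snth_pos)
    then show ?thesis using k(2) by (auto simp: is_factor_def occurs_at_append1)
  qed
  then show ?thesis using rsp unfolding right_special_def by metis
qed

section \<open>Preimages of prefixes and the theorem\<close>

lemma ex_pos: "\<exists>k. pos s k = n \<or> (pos s k = Suc n \<and> n > 0 \<and> Phi s !! (n - 1) = 1)"
proof (induction n)
  case 0
  show ?case by (intro exI[of _ 0]) simp
next
  case (Suc n)
  then obtain k where "pos s k = n \<or> pos s k = Suc n" by blast
  then show ?case
  proof
    assume k: "pos s k = n"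
    then show ?thesis
      using Phi_snth_pos[of s k]
      \<comment> \<open>A block 0 ends at \<open>Suc n\<close>; a block 10 ends one place later and
        has its 1 at \<open>n\<close>.\<close>
      by (intro exI[of _ "Suc k"], cases "s !! k = 0") (simp_all add: pos_Suc phi_a_nonzero)
  qed blast
qed

lemma length_le_length_phi: "length w \<le> length (phi w)"
  by (induction w) (auto simp: phi_a_def)

lemma return_words_append1:
  assumes "\<And>i. occurs_at w u i \<Longrightarrow> u !! (i + length w) = x"
  shows "return_words u (w @ [x]) = return_words u w"
proof -
  have "occurs_at (w @ [x]) u = occurs_at w u"
    using assms by (auto simp: occurs_at_append1 fun_eq_iff)
  then show ?thesis by (simp add: return_words_def consecutive_occurrences_def)
qed

text \<open>If \<open>w\<close> ends at a block boundary, it is an image. Otherwise it ends in the 1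
  of a block 10; then every occurrence is followed by 0, so \<open>w\<close> is not right special
  and appending 0 leaves the return words unchanged.\<close>

lemma prefix_preimage:
  assumes s: "sset s \<subseteq> {0, 1}" and hd: "shd s = 1" and w: "w \<noteq> []" "is_prefix w (Phi s)"
  obtains w' where "w' \<noteq> []" "set w' \<subseteq> {0, 1}" "hd w' = 1" "is_prefix w' s" "length w' \<le> length w"
    "return_words (Phi s) w = return_words (Phi s) (phi w')"
    "right_special w (Phi s) \<Longrightarrow> right_special w' s"
proof -
  let ?n = "length w"
  have prefix: "stake (pos s k) (Phi s) = phi (stake k s)" for k
    by (metis Phi_shift pos_def stake_sdrop stake_shift append_Nil2 diff_self_eq_0 order_refl
        stake.simps(1) take_all)
  have stake: "set (stake k s) \<subseteq> {0, 1}" "is_prefix (stake k s) s"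
    "k > 0 \<Longrightarrow> stake k s \<noteq> [] \<and> hd (stake k s) = 1" for k
    using set_stake_subset[of k 0 s] s hd by (cases k; auto simp: is_prefix_def occurs_at_def)+
  have w_eq: "w = stake ?n (Phi s)" using w(2) by (simp add: is_prefix_def occurs_at_def)
  obtain k where k: "pos s k = ?n \<or> (pos s k = Suc ?n \<and> ?n > 0 \<and> Phi s !! (?n - 1) = 1)"
    using ex_pos by blast
  then have "k > 0" using w(1) by (cases k) auto
  note stake = stake(1,2)[of k] stake(3)[OF \<open>k > 0\<close>]
  from k show thesis
  proof
    assume "pos s k = ?n"
    then have "w = phi (stake k s)" using prefix w_eq by metis
    then show thesis
      using that[of "stake k s"] stake right_special_phiD[OF s, of "stake k s"]
        length_le_length_phi[of "stake k s"] by simp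
  next
    assume k1: "pos s k = Suc ?n \<and> ?n > 0 \<and> Phi s !! (?n - 1) = 1"
    have last: "Phi s !! (i + ?n) = 0" if "occurs_at w (Phi s) i" for i
    proof -
      have "Phi s !! (i + (?n - 1)) = w ! (?n - 1)"
        using that k1 unfolding occurs_at_iff_fac by (metis nth_fac diff_less zero_less_one)
      also have "\<dots> = Phi s !! (?n - 1)" using k1 by (subst w_eq) simp
      finally have "Phi s !! Suc (i + (?n - 1)) = 0" using k1 Phi_snth_Suc by metis
      moreover have "Suc (i + (?n - 1)) = i + ?n" using k1 by simp
      ultimately show ?thesis by metis
    qed
    have "phi (stake k s) = w @ [Phi s !! ?n]"
      using prefix[of k] k1 by (simp add: stake_Suc w_eq[symmetric] del: stake.simps)
    then have phi: "phi (stake k s) = w @ [0]"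
      using last[of 0] w(2) by (simp add: is_prefix_def)
    obtain k' where k': "k = Suc k'" using \<open>k > 0\<close> gr0_implies_Suc by blast
    \<comment> \<open>The initial 1 has an image of length two, which makes up for the appended
      0.\<close>
    have "Suc k \<le> length (phi (stake k s))"
      unfolding k' using hd length_le_length_phi[of "stake k' (stl s)"] by (simp add: phi_a_def)
    then have "k \<le> ?n" by (simp add: phi)
    moreover have "\<not> right_special w (Phi s)"
      using last by (auto simp: right_special_def is_factor_def occurs_at_append1)
    ultimately show thesis
      using that[of "stake k s"] stake return_words_append1[OF last] by (simp add: phi)
  qed
qed

theorem mainTheorem6:
  fixes u u' :: "nat stream"
  assumes "sturmian u" and "sset u \<subseteq> {0, 1}"
    and "sturmian u'" and "sset u' \<subseteq> {0, 1}"
    and "shd u = 1"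
    and "u = flat (smap phi_a u')"
  shows "shd u' = 1 \<and> Der u = Der u' \<and>
    (\<forall>w. w \<noteq> [] \<and> is_prefix w u \<longrightarrow>
      (\<exists>w'. w' \<noteq> [] \<and> is_prefix w' u' \<and> length w' \<le> length w \<and>
        (\<exists>s s'. derivated_word u w s \<and> derivated_word u' w' s' \<and> (s, s') \<in> renaming) \<and>
        (right_special w u \<longrightarrow> right_special w' u')))"
proof -
  \<comment> \<open>An initial 0 of \<open>u'\<close> would give an initial 0 of
    \<open>u\<close>.\<close>
  have "shd u' \<noteq> 0"
    using assms(5) by (intro notI) (simp add: assms(6))
  then have hd: "shd u' = 1" using assms(4) shd_sset[of u'] by auto
  have pre: "\<exists>w'. w' \<noteq> [] \<and> is_prefix w' u' \<and> length w' \<le> length w \<and>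
      (\<forall>s. derivated_word u w s \<longleftrightarrow> derivated_word u' w' s) \<and>
      (right_special w u \<longrightarrow> right_special w' u')" if w: "w \<noteq> []" "is_prefix w u" for w
  proof -
    obtain w' where w': "w' \<noteq> []" "set w' \<subseteq> {0, 1}" "hd w' = 1" "is_prefix w' u'" "length w' \<le> length w"
      "return_words u w = return_words u (phi w')" "right_special w u \<Longrightarrow> right_special w' u'"
      using prefix_preimage[OF assms(4) hd w(1)] w(2) unfolding assms(6) by metis
    have "return_words u w = phi ` return_words u' w'"
      using return_words_phi[OF assms(4) w'(2,1,3)] w'(6) assms(6) by metis
    then show ?thesis using derivated_word_phi_iff[OF assms(4)] w' assms(6) by metis
  qed
  have post: "\<exists>w. w \<noteq> [] \<and> is_prefix w u \<and> (\<forall>s. derivated_word u w s \<longleftrightarrow> derivated_word u' w' s)"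
    if w': "w' \<noteq> []" "is_prefix w' u'" for w'
  proof (intro exI conjI allI)
    have w'_eq: "stake (length w') u' = w'" using w'(2) by (simp add: is_prefix_def occurs_at_def)
    have set: "set w' \<subseteq> {0, 1}"
      using set_stake_subset[of "length w'" 0 u'] assms(4) w'_eq by simp
    have "hd w' = 1" using w'(1) w'_eq hd by (cases w') auto
    then show "derivated_word u (phi w') s \<longleftrightarrow> derivated_word u' w' s" for s
      using derivated_word_phi_iff[OF assms(4) return_words_phi] assms(4,6) set w'(1) by metis
    show "is_prefix (phi w') u"
      using stake_Phi_iff[OF set assms(4)] w'_eq by (simp add: is_prefix_def occurs_at_def assms(6))
    show "phi w' \<noteq> []" using w'(1) by (cases w') auto
  qed
  \<comment> \<open>The sets agree even before the quotient by renaming is taken.\<close>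
  have "{s. \<exists>w. w \<noteq> [] \<and> is_prefix w u \<and> derivated_word u w s}
      = {s. \<exists>w. w \<noteq> [] \<and> is_prefix w u' \<and> derivated_word u' w s}"
    using pre post by blast
  then have "Der u = Der u'" by (simp add: Der_def)
  moreover have "\<exists>w'. w' \<noteq> [] \<and> is_prefix w' u' \<and> length w' \<le> length w \<and>
        (\<exists>s s'. derivated_word u w s \<and> derivated_word u' w' s' \<and> (s, s') \<in> renaming) \<and>
        (right_special w u \<longrightarrow> right_special w' u')" if w: "w \<noteq> [] \<and> is_prefix w u" for w
  proof -
    obtain s where "derivated_word u w s"
      using derivated_word_exists[OF assms(1)] finite_subset[OF assms(2)] w by auto
    moreover have "(s, s) \<in> renaming"
      by (auto simp: renaming_def stream.map_id intro!: exI[of _ id])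
    ultimately show ?thesis using pre[of w] w by blast
  qed
  ultimately show ?thesis using hd by blast
qed

end
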